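(* Let $p\neq 2$ be a prime, $k\geq 1$ an integer, and let $f(x)=x^6+ax^3+b\in\mathbb{F}_{p^k}[x]$. Put $\Delta=a^2-4b$. Then: 1. when $p^k\not\equiv 1 \bmod 3$ and $p\neq 3$, the polynomial $f(x)$ is irreducible over $\mathbb{F}_{p^k}$ if and only if $R(x)=x^3-3bx+ab$ is irreducible over $\mathbb{F}_{p^k}$; 2. when $p^k\equiv 1\bmod 3$, the polynomial $f(x)$ is irreducible over $\mathbb{F}_{p^k}$ if and only if $\sqrt[3]{b}\notin\mathbb{F}_{p^k}$ and $\sqrt{\Delta}\notin\mathbb{F}_{p^k}$; 3. when $p=3$, the polynomial $f(x)$ is never irreducible over $\mathbb{F}_{p^k}$.
   Context: $\mathbb{F}_{p^k}$ is the finite field with $p^k$ elements. "$\sqrt[3]{b}\notin \mathbb{F}_{p^k}$" means that none of the cubic roots of $b$ belongs to $\mathbb{F}_{p^k}$, i.e. $b$ is not a cube in $\mathbb{F}_{p^k}$; "$\sqrt{\Delta}\notin\mathbb{F}_{p^k}$" means that $\Delta$ is not a square in $\mathbb{F}_{p^k}$. *)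

theory Defs
  imports
    "HOL-Library.Cardinality"
    "HOL-Computational_Algebra.Computational_Algebra"
    "HOL-Number_Theory.Cong"
begin

end

theory Submission
  imports Defs
begin

text \<open>
  Since \<open>4f = (2x\<^sup>3 + a)\<^sup>2 - \<Delta>\<close>, a square \<open>\<Delta>\<close> makes \<open>f\<close> split into two cubics, while for
  a nonsquare \<open>\<Delta>\<close> no factor of \<open>f\<close> has odd degree. In the latter case \<open>f\<close> is reducible iff
  some \<open>x\<^sup>2 - tx + c\<close> divides it, and division with remainder turns this into \<open>c\<^sup>3 = b\<close> and
  \<open>t\<^sup>3 - 3ct + a = 0\<close>. If cubing is bijective, \<open>c\<close> is determined by \<open>b\<close>, and \<open>x = ct\<close> turns the
  cubic equation into \<open>R(x) = 0\<close>. If the field has \<open>q \<equiv> 1 mod 3\<close> elements, then \<open>-3\<close> is a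
  square, and an injectivity argument shows that the cubic in \<open>t\<close> always has a root. In
  characteristic 3, \<open>f\<close> is a cube.
\<close>

section \<open>Factors of polynomials over a field\<close>

text \<open>The smaller of two proper factors, made monic. For a cubic this leaves only degree 1,
  for a sextic only degrees 1, 2 and 3.\<close>

lemma reducible_poly_small_factor:
  fixes f :: "'a::field poly"
  assumes "degree f > 0" and "\<not> irreducible f"
  obtains h where "h dvd f" and "lead_coeff h = 1" and "degree h > 0" and "2 * degree h \<le> degree f"
proof -
  have "f \<noteq> 0" using assms by auto
  then obtain g1 g2 where f: "f = g1 * g2" and nu: "\<not> g1 dvd 1" "\<not> g2 dvd 1"
    using assms by (auto simp: irreducible_def is_unit_iff_degree)
  have nz: "g1 \<noteq> 0" "g2 \<noteq> 0" using f \<open>f \<noteq> 0\<close> by auto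
  then have deg: "degree g1 > 0" "degree g2 > 0" "degree f = degree g1 + degree g2"
    using nu f by (auto simp: is_unit_iff_degree degree_mult_eq)
  have "\<exists>g. g dvd f \<and> g \<noteq> 0 \<and> degree g > 0 \<and> 2 * degree g \<le> degree f"
  proof (cases "degree g1 \<le> degree g2")
    case True
    with deg f nz show ?thesis by (intro exI[of _ g1]) auto
  next
    case False
    with deg f nz show ?thesis by (intro exI[of _ g2]) auto
  qed
  then obtain g where g: "g dvd f" "g \<noteq> 0" "degree g > 0" "2 * degree g \<le> degree f" by blast
  show ?thesis
  proof (rule that[of "smult (inverse (lead_coeff g)) g"])
    show "smult (inverse (lead_coeff g)) g dvd f" using g by (simp add: smult_dvd)
  qed (use g in auto)
qed

lemma irreducible_cubic_iff_no_root:
  fixes f :: "'a::field poly"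
  assumes "degree f = 3"
  shows "irreducible f \<longleftrightarrow> (\<nexists>x. poly f x = 0)"
proof
  assume irr: "irreducible f"
  show "\<nexists>x. poly f x = 0"
  proof
    assume "\<exists>x. poly f x = 0"
    then obtain x g where fg: "f = [:-x, 1:] * g" by (auto simp: poly_eq_0_iff_dvd dvd_def)
    moreover have "g \<noteq> 0" using fg assms by auto
    ultimately have "degree f = degree [:-x, 1:] + degree g"
      unfolding fg by (intro degree_mult_eq) auto
    then have "degree g > 0" using assms by simp
    with fg irr show False using reducible_polyI[of f "[:-x, 1:]" g] by simp
  qed
next
  assume nr: "\<nexists>x. poly f x = 0"
  show "irreducible f"
  proof (rule ccontr)
    assume "\<not> irreducible f"
    then obtain h where h: "h dvd f" "lead_coeff h = 1" "degree h > 0" "2 * degree h \<le> degree f"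
      using reducible_poly_small_factor[of f] assms by auto
    then have "degree h = 1" using assms by linarith
    then obtain u v where "h = [:u, v:]" "v \<noteq> 0" using degree1_coeffs by blast
    with h(2) have "poly h (-u) = 0" by auto
    with h(1) nr show False by (auto simp: dvd_def)
  qed
qed

text \<open>A square root of \<open>D\<close> modulo an odd-degree polynomial \<open>h\<close> descends to the ground
  field: reducing \<open>w\<close> modulo \<open>h\<close>, the cofactor of \<open>h\<close> in \<open>w\<^sup>2 - D\<close> has again odd,
  but smaller, degree.\<close>

lemma odd_degree_dvd_square_minus_const:
  fixes h w :: "'a::field poly"
  assumes "odd (degree h)" and "h dvd w\<^sup>2 - [:D:]"
  shows "\<exists>d. d\<^sup>2 = D"
  using assms
proof (induction "degree h" arbitrary: h w rule: less_induct)
  case less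
  define v where "v = w mod h"
  have "h \<noteq> 0" using less.prems(1) by auto
  have "v\<^sup>2 - [:D:] = (w\<^sup>2 - [:D:]) - (w - v) * (w + v)"
    by (simp add: algebra_simps power2_eq_square)
  moreover have "h dvd w - v" by (simp add: v_def dvd_minus_mod)
  ultimately have dvd: "h dvd v\<^sup>2 - [:D:]" using less.prems(2) by (metis dvd_diff dvd_mult2)
  have vh: "degree v < degree h"
    using degree_mod_less[OF \<open>h \<noteq> 0\<close>, of w] less.prems(1) by (auto simp: v_def elim: oddE)
  show ?case
  proof (cases "degree v = 0")
    case True
    then obtain e where e: "v = [:e:]" by (rule degree_eq_zeroE)
    have "v\<^sup>2 - [:D:] = [:e\<^sup>2 - D:]" by (simp add: e power2_eq_square)
    then have "e\<^sup>2 - D = 0" using dvd vh dvd_imp_degree_le[of h "v\<^sup>2 - [:D:]"] by auto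
    then show ?thesis by auto
  next
    case False
    have "degree (v\<^sup>2) = 2 * degree v" using False by (subst degree_power_eq) auto
    then have "degree (v\<^sup>2 + [:-D:]) = 2 * degree v"
      using False by (subst degree_add_eq_left) auto
    then have d2: "degree (v\<^sup>2 - [:D:]) = 2 * degree v"
      by (simp only: diff_conv_add_uminus minus_pCons minus_zero)
    obtain g where g: "v\<^sup>2 - [:D:] = h * g" using dvd by (auto simp: dvd_def)
    have "g \<noteq> 0" using g d2 False by auto
    then have "degree h + degree g = 2 * degree v"
      using g d2 \<open>h \<noteq> 0\<close> by (simp add: degree_mult_eq)
    then have "degree g < degree h" "odd (degree g)"
      using vh less.prems(1) by (linarith, metis dvd_triv_left even_add)
    moreover have "g dvd v\<^sup>2 - [:D:]" using g by simp
    ultimately show ?thesis using less.hyps by blast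
  qed
qed

section \<open>The sextic over an arbitrary field\<close>

text \<open>Dividing \<open>?f\<close> by \<open>?h\<close> leaves a remainder of degree at most 1,
  which must vanish. Its linear coefficient factors, and the nonsquare hypothesis excludes
  \<open>t^2 = c\<close>.\<close>

lemma quadratic_dvd_sextic_iff:
  fixes a b c t :: "'a::field"
  assumes nsq: "\<nexists>d. d\<^sup>2 = a\<^sup>2 - 4 * b"
  shows "[:c, -t, 1:] dvd [:b, 0, 0, a, 0, 0, 1:] \<longleftrightarrow> c ^ 3 = b \<and> t ^ 3 - 3 * c * t + a = 0"
    (is "?h dvd ?f \<longleftrightarrow> _")
proof -
  define q1 where "q1 = t ^ 3 - 2 * c * t + a"
  define q0 where "q0 = t * q1 - c * (t\<^sup>2 - c)"
  have div: "?f = ?h * [:q0, q1, t\<^sup>2 - c, t, 1:] + [:b - c * q0, (t\<^sup>2 - c) * (t ^ 3 - 3 * c * t + a):]"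
    by (simp add: q0_def q1_def algebra_simps power2_eq_square power3_eq_cube)
  show ?thesis
  proof
    assume "?h dvd ?f"
    then have "?h dvd [:b - c * q0, (t\<^sup>2 - c) * (t ^ 3 - 3 * c * t + a):]" (is "_ dvd ?r")
      using div by (metis dvd_add_right_iff dvd_triv_left)
    moreover have "degree ?r < degree ?h" by simp
    ultimately have "?r = 0" using dvd_imp_degree_le[of ?h ?r] by linarith
    then have E: "b = c * q0" "t\<^sup>2 = c \<or> t ^ 3 - 3 * c * t + a = 0" by auto
    have "t\<^sup>2 \<noteq> c"
    proof
      assume "t\<^sup>2 = c"
      then have "c = t * t" by (simp add: power2_eq_square)
      \<comment> \<open>Here \<open>q1 = a - t ^ 3\<close>, so
        \<open>b = t ^ 3 * (a - t ^ 3)\<close>.\<close>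
      then have "(a - 2 * t ^ 3)\<^sup>2 = a\<^sup>2 - 4 * b"
        unfolding E(1) q0_def q1_def by (simp add: algebra_simps eval_nat_numeral)
      then show False using nsq by blast
    qed
    then have t: "t ^ 3 - 3 * c * t + a = 0" using E(2) by blast
    \<comment> \<open>The cubic equation gives \<open>q1 = c * t\<close>, hence
      \<open>q0 = c^2\<close>.\<close>
    moreover have "c ^ 3 = b"
      unfolding E(1) q0_def q1_def using t by algebra
    ultimately show "c ^ 3 = b \<and> t ^ 3 - 3 * c * t + a = 0" by blast
  next
    assume ct: "c ^ 3 = b \<and> t ^ 3 - 3 * c * t + a = 0"
    have "q1 = c * t + (t ^ 3 - 3 * c * t + a)" by (simp add: q1_def)
    with ct have "b - c * q0 = 0" by (simp add: q0_def algebra_simps power2_eq_square power3_eq_cube)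
    with ct have "?f = ?h * [:q0, q1, t\<^sup>2 - c, t, 1:]" by (subst div) simp
    then show "?h dvd ?f" by (metis dvd_triv_left)
  qed
qed

lemma irreducible_sextic_iff_nonsquare:
  fixes a b :: "'a::field"
  assumes nsq: "\<nexists>d. d\<^sup>2 = a\<^sup>2 - 4 * b"
  shows "irreducible [:b, 0, 0, a, 0, 0, 1:] \<longleftrightarrow> (\<nexists>c t. c ^ 3 = b \<and> t ^ 3 - 3 * c * t + a = 0)"
    (is "irreducible ?f \<longleftrightarrow> _")
proof
  assume irr: "irreducible ?f"
  show "\<nexists>c t. c ^ 3 = b \<and> t ^ 3 - 3 * c * t + a = 0"
  proof
    assume "\<exists>c t. c ^ 3 = b \<and> t ^ 3 - 3 * c * t + a = 0"
    then obtain c t where "[:c, -t, 1:] dvd ?f" using quadratic_dvd_sextic_iff[OF nsq] by blast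
    then obtain g where g: "?f = [:c, -t, 1:] * g" by (auto simp: dvd_def)
    have "g \<noteq> 0" using g by fastforce
    then have "degree ?f = degree [:c, -t, 1:] + degree g"
      unfolding g by (intro degree_mult_eq) auto
    then have "degree g > 0" by simp
    then show False using irr g reducible_polyI[of ?f "[:c, -t, 1:]" g] by simp
  qed
next
  assume no: "\<nexists>c t. c ^ 3 = b \<and> t ^ 3 - 3 * c * t + a = 0"
  show "irreducible ?f"
  proof (rule ccontr)
    assume "\<not> irreducible ?f"
    then obtain h where h: "h dvd ?f" "lead_coeff h = 1" "degree h > 0" "2 * degree h \<le> degree ?f"
      using reducible_poly_small_factor[of ?f] by auto
    have "odd (degree h) \<or> degree h = 2" using h(3,4) by auto
    then show False
    proof
      assume odd: "odd (degree h)"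
      have "[:a, 0, 0, 2:]\<^sup>2 - [:a\<^sup>2 - 4 * b:] = smult 4 ?f"
        by (simp add: power2_eq_square algebra_simps)
      then have "h dvd [:a, 0, 0, 2:]\<^sup>2 - [:a\<^sup>2 - 4 * b:]" using h(1) by (simp only: dvd_smult)
      then show False using odd_degree_dvd_square_minus_const[OF odd] nsq by blast
    next
      assume deg: "degree h = 2"
      have "h = [:coeff h 0, - (- coeff h 1), 1:]"
      proof (rule poly_eqI)
        fix n :: nat
        consider "n = 0" | "n = 1" | "n = 2" | "n > 2" by linarith
        then show "coeff h n = coeff [:coeff h 0, - (- coeff h 1), 1:] n"
          using h(2) deg by cases (auto simp: coeff_eq_0 coeff_pCons numeral_2_eq_2 split: nat.splits)
      qed
      then show False using h(1) no quadratic_dvd_sextic_iff[OF nsq] by metis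
    qed
  qed
qed

text \<open>The quadratic formula for \<open>y^2 + a * y + b\<close>; with \<open>y = x^3\<close>
  its roots give the factors \<open>x^3 - r\<close> and \<open>x^3 - s\<close> of the
  sextic.\<close>

lemma quadratic_split:
  fixes a b d :: "'a::field"
  assumes "(2::'a) \<noteq> 0" and "d\<^sup>2 = a\<^sup>2 - 4 * b"
  obtains r s where "r + s = -a" and "r * s = b"
proof
  have "(-a + d) / 2 + (-a - d) / 2 = 2 * (-a) / 2" unfolding add_divide_distrib[symmetric] by simp
  then show "(-a + d) / 2 + (-a - d) / 2 = -a" using assms(1) by simp
  have "(-a + d) * (-a - d) = 4 * b" using assms(2) by algebra
  moreover have "(4::'a) \<noteq> 0" using assms(1) mult_eq_0_iff[of "2::'a" 2] by auto
  ultimately show "(-a + d) / 2 * ((-a - d) / 2) = b" by (simp only: times_divide_times_eq) simp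
qed

lemma reducible_sextic_square:
  fixes a b d :: "'a::field"
  assumes "(2::'a) \<noteq> 0" and "d\<^sup>2 = a\<^sup>2 - 4 * b"
  shows "\<not> irreducible [:b, 0, 0, a, 0, 0, 1:]"
proof -
  obtain r s where "r + s = -a" "r * s = b" using quadratic_split[OF assms] .
  then have "a = - r - s" "b = r * s" by (metis add.inverse_inverse minus_add_distrib diff_conv_add_uminus, simp)
  then have "[:b, 0, 0, a, 0, 0, 1:] = [:-r, 0, 0, 1:] * [:-s, 0, 0, 1:]" by simp
  then show ?thesis by (rule reducible_polyI) auto
qed

section \<open>Cubes in finite fields\<close>

text \<open>Multiplication by \<open>x\<close> permutes the nonzero elements, so their product can
  be cancelled.\<close>

lemma power_card_minus_one_eq_1:
  fixes x :: "'a::{field,finite}"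
  assumes "x \<noteq> 0"
  shows "x ^ (CARD('a) - 1) = 1"
proof -
  let ?P = "\<Prod>y\<in>-{0::'a}. y"
  have "?P = (\<Prod>y\<in>-{0}. x * y)"
    by (rule prod.reindex_bij_witness[of _ "\<lambda>y. x * y" "\<lambda>y. y / x"]) (use assms in auto)
  also have "\<dots> = x ^ (CARD('a) - 1) * ?P"
    by (simp add: prod.distrib Compl_eq_Diff_UNIV card_Diff_singleton)
  finally show ?thesis by simp
qed

lemma power_card_eq_same:
  fixes x :: "'a::{field,finite}"
  shows "x ^ CARD('a) = x"
  using power_card_minus_one_eq_1[of x] zero_less_card_finite[where ?'a = 'a]
  by (cases "x = 0") (auto simp: power_eq_if)

text \<open>Translation by 1 permutes the field, so comparing the sums of all elements shows that
  the cardinality is zero in the field.\<close>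

lemma CHAR_eq_if_card_prime_power:
  assumes "prime p" and "CARD('a::{field,finite}) = p ^ k"
  shows "CHAR('a) = p"
proof -
  have "(\<Sum>y\<in>UNIV. y) = (\<Sum>y\<in>UNIV. y + 1 :: 'a)"
    by (rule sum.reindex_bij_witness[of _ "\<lambda>y. y + 1" "\<lambda>y. y - 1"]) auto
  then have "of_nat CARD('a) = (0::'a)" by (simp add: sum.distrib)
  then have "CHAR('a) dvd p ^ k" by (simp only: assms(2) of_nat_eq_0_iff_char_dvd)
  moreover have "prime CHAR('a)" using finite_imp_CHAR_pos[where ?'a = 'a] prime_CHAR_semidom by auto
  ultimately show ?thesis using assms(1) by (metis prime_dvd_power primes_dvd_imp_eq)
qed

text \<open>With q elements, both exponents q and 2q - 1 fix every \<open>x\<close>. One of them is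
  a multiple \<open>3 * m\<close>, so \<open>x ^ m\<close> is a cube root of
  \<open>x\<close>.\<close>

lemma bij_cube:
  assumes "CARD('a::{field,finite}) mod 3 \<noteq> 1"
  shows "bij (\<lambda>x::'a. x ^ 3)"
proof -
  have "surj (\<lambda>x::'a. x ^ 3)"
  proof -
    have "\<exists>m. CARD('a) = 3 * m \<or> 2 * CARD('a) - 1 = 3 * m"
      using assms by presburger
    then obtain m where "CARD('a) = 3 * m \<or> 2 * CARD('a) - 1 = 3 * m" ..
    then have "x = (x ^ m) ^ 3" for x :: 'a
    proof
      assume "CARD('a) = 3 * m"
      then show ?thesis using power_card_eq_same[of x] by (metis mult.commute power_mult)
    next
      assume m: "2 * CARD('a) - 1 = 3 * m"
      have "2 * CARD('a) - 1 = CARD('a) + (CARD('a) - 1)"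
        using zero_less_card_finite[where ?'a = 'a] by linarith
      then have "x ^ (3 * m) = x * x ^ (CARD('a) - 1)"
        using m by (metis power_add power_card_eq_same)
      also have "\<dots> = x" using power_card_minus_one_eq_1[of x] by (cases "x = 0") auto
      finally show ?thesis by (metis mult.commute power_mult)
    qed
    then show ?thesis by (metis surjI)
  qed
  then show ?thesis by (simp add: bij_def finite_UNIV_surj_inj)
qed

text \<open>A primitive cube root of unity \<open>y\<close> satisfies
  \<open>y^2 + y + 1 = 0\<close>, so \<open>2 * y + 1\<close> squares to -3.\<close>

lemma exists_square_eq_minus_3:
  assumes "CARD('a::{field,finite}) mod 3 = 1"
  obtains e :: "'a::{field,finite}" where "e\<^sup>2 = -3" and "e \<noteq> 0"
proof -
  define m where "m = (CARD('a) - 1) div 3"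
  have q: "CARD('a) - 1 = m * 3" using assms unfolding m_def by presburger
  have "card {0, 1::'a} \<le> CARD('a)" by (rule card_mono) auto
  then have "m > 0" using q by (cases "m = 0") auto
  \<comment> \<open>This polynomial has too few roots to vanish at all nonzero \<open>x\<close>, so
    some \<open>x ^ m\<close> is a cube root of unity other than 1.\<close>
  let ?P = "monom (1::'a) m + [:-1:]"
  have deg: "degree ?P = m"
    using \<open>m > 0\<close> by (subst degree_add_eq_left) (simp_all add: degree_monom_eq)
  then have "card {x. poly ?P x = 0} \<le> m" using card_poly_roots_bound[of ?P] \<open>m > 0\<close> by force
  also have "\<dots> < CARD('a) - 1" using \<open>m > 0\<close> q by simp
  also have "\<dots> = card (-{0::'a})" by (simp add: Compl_eq_Diff_UNIV card_Diff_singleton)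
  finally have "\<not> -{0} \<subseteq> {x. poly ?P x = 0}" by (meson card_mono finite linorder_not_less)
  then obtain x :: 'a where x: "x \<noteq> 0" "x ^ m \<noteq> 1" by (auto simp: poly_monom)
  define y where "y = x ^ m"
  have "y ^ 3 = 1" using power_card_minus_one_eq_1[OF x(1)] by (simp only: y_def q power_mult)
  then have "(y - 1) * (y\<^sup>2 + y + 1) = 0" by algebra
  then have y: "y\<^sup>2 + y + 1 = 0" "y \<noteq> 1" using x(2) by (auto simp: y_def)
  show ?thesis
  proof
    show e: "(2 * y + 1)\<^sup>2 = -3" using y(1) by algebra
    show "2 * y + 1 \<noteq> 0"
    proof
      assume "2 * y + 1 = 0"
      then have "(3::'a) = 0" using e by simp
      moreover have "(y - 1)\<^sup>2 = (y\<^sup>2 + y + 1) - 3 * y" by (simp add: power2_eq_square algebra_simps)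
      ultimately have "(y - 1)\<^sup>2 = 0" using y(1) by simp
      then show False using y(2) by simp
    qed
  qed
qed

text \<open>If \<open>t = u + c/u\<close>, then \<open>t\<^sup>3 - 3ct = u\<^sup>3 + c\<^sup>3/u\<^sup>3\<close>, and \<open>t\<^sup>2 - 4c\<close> is a nonsquare iff \<open>u\<close> lies in
  the quadratic extension but not in the ground field. On such \<open>t\<close> the map is injective when
  \<open>-3\<close> is a square, and after division by \<open>c\<close> it becomes a self-map, hence is surjective.\<close>

lemma depressed_cubic_root_exists:
  fixes a c e :: "'a::{field,finite}"
  assumes e: "e\<^sup>2 = -3" "e \<noteq> 0" and nsq: "\<nexists>d. d\<^sup>2 = a\<^sup>2 - 4 * c ^ 3"
  shows "\<exists>t. t ^ 3 - 3 * c * t + a = 0"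
proof -
  have c: "c \<noteq> 0" using nsq by auto
  define T where "T = {t. \<nexists>d. d\<^sup>2 = t\<^sup>2 - 4 * c}"
  define g where "g t = (3 * c * t - t ^ 3) / c" for t
  have cg: "c * g t = 3 * c * t - t ^ 3" for t using c by (simp add: g_def)
  have "g ` T \<subseteq> T"
  proof (rule image_subsetI)
    fix t assume t: "t \<in> T"
    have nc: "t\<^sup>2 - c \<noteq> 0"
    proof
      assume "t\<^sup>2 - c = 0"
      \<comment> \<open>If \<open>c = t^2\<close>, both sides equal \<open>-3 * t^2\<close>.\<close>
      then have "(e * t)\<^sup>2 = t\<^sup>2 - 4 * c" using e(1) by algebra
      then show False using t unfolding T_def by blast
    qed
    show "g t \<in> T"
      unfolding T_def
    proof safe
      fix d assume "d\<^sup>2 = (g t)\<^sup>2 - 4 * c"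
      \<comment> \<open>The identity \<open>(3ct - t^3)^2 - 4c^3 = (t^2 - c)^2 * (t^2 - 4c)\<close>
        is behind this.\<close>
      then have "(c * d)\<^sup>2 = (t\<^sup>2 - c)\<^sup>2 * (t\<^sup>2 - 4 * c)" using cg[of t] by algebra
      then have "(c * d / (t\<^sup>2 - c))\<^sup>2 = t\<^sup>2 - 4 * c" using nc by (simp add: power_divide)
      then show False using t unfolding T_def by blast
    qed
  qed
  moreover have "inj_on g T"
  proof (rule inj_onI, rule ccontr)
    fix t u assume t: "t \<in> T" and "g t = g u" and "t \<noteq> u"
    have "(t - u) * (t\<^sup>2 + t * u + u\<^sup>2 - 3 * c) = c * g u - c * g t"
      unfolding cg by (simp add: algebra_simps eval_nat_numeral)
    then have "(t - u) * (t\<^sup>2 + t * u + u\<^sup>2 - 3 * c) = 0" using \<open>g t = g u\<close> by simp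
    then have "t\<^sup>2 + t * u + u\<^sup>2 = 3 * c" using \<open>t \<noteq> u\<close> by simp
    \<comment> \<open>Completing the square in \<open>u\<close>: the discriminant of the quadratic
      is \<open>-3 * (t^2 - 4c)\<close>.\<close>
    then have "(2 * u + t)\<^sup>2 = e\<^sup>2 * (t\<^sup>2 - 4 * c)" using e(1) by algebra
    then have "((2 * u + t) / e)\<^sup>2 = t\<^sup>2 - 4 * c" using e(2) by (simp add: power_divide)
    then show False using t unfolding T_def by blast
  qed
  ultimately have surj: "g ` T = T" by (intro endo_inj_surj) auto
  have "a / c \<in> T"
    unfolding T_def
  proof safe
    fix d assume d: "d\<^sup>2 = (a / c)\<^sup>2 - 4 * c"
    obtain x where x: "a = c * x" using c by (metis dvd_field_iff dvdE)
    then have "(c * d)\<^sup>2 = a\<^sup>2 - 4 * c ^ 3" using d c by simp algebra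
    then show False using nsq by blast
  qed
  then obtain t where "a / c = g t" using surj by auto
  then have "a = 3 * c * t - t ^ 3" using c cg[of t] by (metis nonzero_eq_divide_eq mult.commute)
  then show ?thesis by (intro exI[of _ t]) simp
qed

section \<open>Irreducibility criteria\<close>

text \<open>For a nonsquare discriminant, \<open>x = c * t\<close> matches the roots of the two
  cubics. For a square one both polynomials are reducible, the resolvent by Cardano's
  formula.\<close>

lemma irreducible_sextic_iff_resolvent:
  fixes a b :: "'a::field"
  assumes two: "(2::'a) \<noteq> 0" and bij: "bij (\<lambda>x::'a. x ^ 3)"
  shows "irreducible [:b, 0, 0, a, 0, 0, 1:] \<longleftrightarrow> irreducible [:a * b, -(3 * b), 0, 1:]"
proof -
  have cube_inj: "x = y" if "x ^ 3 = y ^ 3" for x y :: 'a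
    using bij that by (simp add: bij_def inj_def)
  obtain c where c: "c ^ 3 = b" using bij by (metis bij_pointE)
  have R: "irreducible [:a * b, -(3 * b), 0, 1:] \<longleftrightarrow> (\<nexists>x. x ^ 3 - 3 * b * x + a * b = 0)"
    by (subst irreducible_cubic_iff_no_root) (auto simp: power3_eq_cube algebra_simps)
  have Rc: "(c * t) ^ 3 - 3 * b * (c * t) + a * b = c ^ 3 * (t ^ 3 - 3 * c * t + a)" for t
    by (simp add: c[symmetric] algebra_simps eval_nat_numeral)
  have root: "(\<exists>x. x ^ 3 - 3 * b * x + a * b = 0) \<longleftrightarrow> (\<exists>t. t ^ 3 - 3 * c * t + a = 0)"
    if "c \<noteq> 0"
  proof
    assume "\<exists>x. x ^ 3 - 3 * b * x + a * b = 0"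
    then obtain x where x: "x ^ 3 - 3 * b * x + a * b = 0" ..
    have "c * (x / c) = x" using that by simp
    then have "c ^ 3 * ((x / c) ^ 3 - 3 * c * (x / c) + a) = 0" using Rc[of "x / c"] x by simp
    then show "\<exists>t. t ^ 3 - 3 * c * t + a = 0" using that by (metis mult_eq_0_iff power_not_zero)
  next
    assume "\<exists>t. t ^ 3 - 3 * c * t + a = 0"
    then show "\<exists>x. x ^ 3 - 3 * b * x + a * b = 0" using Rc by (metis mult_zero_right)
  qed
  show ?thesis
  proof (cases "\<exists>d. d\<^sup>2 = a\<^sup>2 - 4 * b")
    case False
    then have "c \<noteq> 0" using c by auto
    have "(\<exists>c' t. c' ^ 3 = b \<and> t ^ 3 - 3 * c' * t + a = 0) \<longleftrightarrow> (\<exists>t. t ^ 3 - 3 * c * t + a = 0)"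
      using c cube_inj by metis
    then show ?thesis
      unfolding R irreducible_sextic_iff_nonsquare[OF False] root[OF \<open>c \<noteq> 0\<close>] by blast
  next
    case True
    then obtain d where d: "d\<^sup>2 = a\<^sup>2 - 4 * b" by blast
    have "\<exists>x. x ^ 3 - 3 * b * x + a * b = 0"
    proof (cases "c = 0")
      case True
      then show ?thesis using c by (intro exI[of _ 0]) auto
    next
      case False
      obtain r s where rs: "r + s = -a" "r * s = b" using quadratic_split[OF two d] .
      \<comment> \<open>Cardano: \<open>u + v\<close> solves the cubic in \<open>t\<close>, as
        \<open>u * v = c\<close> by injectivity of cubing.\<close>
      obtain u v where uv: "u ^ 3 = r" "v ^ 3 = s" using bij by (metis bij_pointE)
      have c_uv: "c = u * v"
        by (rule cube_inj) (simp only: c power_mult_distrib uv rs(2))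
      have a_uv: "a = - (u ^ 3 + v ^ 3)" by (simp only: uv rs(1) minus_minus)
      have "(u + v) ^ 3 - 3 * c * (u + v) + a = 0"
        unfolding c_uv a_uv by (simp add: power3_eq_cube algebra_simps)
      then show ?thesis using root[OF False] by blast
    qed
    then show ?thesis using R reducible_sextic_square[OF two d] by blast
  qed
qed

text \<open>For a nonsquare discriminant every cube root \<open>c\<close> of \<open>b\<close> admits
  a suitable \<open>t\<close>, so a quadratic factor exists exactly when \<open>b\<close> is a
  cube.\<close>

lemma irreducible_sextic_iff_noncube_nonsquare:
  fixes a b :: "'a::{field,finite}"
  assumes two: "(2::'a) \<noteq> 0" and card: "CARD('a) mod 3 = 1"
  shows "irreducible [:b, 0, 0, a, 0, 0, 1:] \<longleftrightarrow>
    (\<nexists>c. c ^ 3 = b) \<and> (\<nexists>d. d\<^sup>2 = a\<^sup>2 - 4 * b)"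
proof (cases "\<exists>d. d\<^sup>2 = a\<^sup>2 - 4 * b")
  case True
  then show ?thesis using reducible_sextic_square[OF two] by blast
next
  case False
  obtain e :: 'a where "e\<^sup>2 = -3" "e \<noteq> 0" using exists_square_eq_minus_3[OF card] .
  then have "\<exists>t. t ^ 3 - 3 * c * t + a = 0" if "c ^ 3 = b" for c
    using depressed_cubic_root_exists[of e a c] False that by blast
  then show ?thesis using irreducible_sextic_iff_nonsquare[OF False] False by blast
qed

lemma reducible_sextic_char_3:
  fixes a b :: "'a::field"
  assumes three: "(3::'a) = 0" and surj: "surj (\<lambda>x::'a. x ^ 3)"
  shows "\<not> irreducible [:b, 0, 0, a, 0, 0, 1:]"
proof -
  obtain u v where uv: "a = u ^ 3" "b = v ^ 3" using surj by (metis surjD)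
  \<comment> \<open>The coefficients are grouped so that every term lost in characteristic 3 shows a
    factor 3.\<close>
  have "[:v, u, 1:] * [:v, u, 1:]\<^sup>2 =
      [:v ^ 3, 3 * (u * v\<^sup>2), 3 * (u\<^sup>2 * v + v\<^sup>2), u ^ 3 + 3 * (2 * u * v), 3 * (u\<^sup>2 + v), 3 * u, 1:]"
    by (simp add: algebra_simps eval_nat_numeral)
  then have "[:b, 0, 0, a, 0, 0, 1:] = [:v, u, 1:] * [:v, u, 1:]\<^sup>2"
    unfolding uv three by simp
  then show ?thesis by (rule reducible_polyI) (auto simp: degree_power_eq)
qed

theorem theorem1p2:
  fixes p k :: nat
    and a b \<Delta> :: "'a :: {field, finite}"
    and f R :: "'a poly"
  assumes "prime p" and "p \<noteq> 2" and "k \<ge> 1"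
    and "CARD('a) = p ^ k"
    and "f = monom 1 6 + monom a 3 + monom b 0"
    and "R = monom 1 3 - monom (3 * b) 1 + monom (a * b) 0"
    and "\<Delta> = a ^ 2 - 4 * b"
  shows "(\<not> [p ^ k = 1] (mod 3) \<and> p \<noteq> 3 \<longrightarrow> (irreducible f \<longleftrightarrow> irreducible R)) \<and>
    ([p ^ k = 1] (mod 3) \<longrightarrow>
      (irreducible f \<longleftrightarrow> (\<nexists>c :: 'a. c ^ 3 = b) \<and> (\<nexists>d :: 'a. d ^ 2 = \<Delta>))) \<and>
    (p = 3 \<longrightarrow> \<not> irreducible f)"
proof -
  have f: "f = [:b, 0, 0, a, 0, 0, 1:]"
    unfolding assms by (simp add: monom_altdef eval_nat_numeral)
  have R: "R = [:a * b, -(3 * b), 0, 1:]"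
    unfolding assms by (simp add: monom_altdef eval_nat_numeral)
  have char: "CHAR('a) = p" using CHAR_eq_if_card_prime_power assms by blast
  have two: "(2::'a) \<noteq> 0"
    using of_nat_eq_0_iff_char_dvd[where ?'a = 'a, of 2] char assms(1,2)
      primes_dvd_imp_eq[of p 2] by auto
  have q: "[p ^ k = 1] (mod 3) \<longleftrightarrow> CARD('a) mod 3 = 1"
    by (simp add: cong_def assms(4))
  have "\<not> irreducible f" if "p = 3"
  proof -
    have "(3::'a) = 0" using of_nat_CHAR[where ?'a = 'a] that char by simp
    \<comment> \<open>As \<open>k\<close> is positive, 3 divides the cardinality, so cubing is
      bijective here too.\<close>
    moreover have "CARD('a) mod 3 \<noteq> 1" using that assms(3,4) by (cases k) auto
    ultimately show ?thesis
      unfolding f by (intro reducible_sextic_char_3 bij_is_surj bij_cube)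
  qed
  moreover have "irreducible f \<longleftrightarrow> irreducible R" if "CARD('a) mod 3 \<noteq> 1"
    unfolding f R using irreducible_sextic_iff_resolvent[OF two bij_cube[OF that]] .
  ultimately show ?thesis
    using irreducible_sextic_iff_noncube_nonsquare[OF two, of b a]
    unfolding q assms(7) f by blast
qed

end
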